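(* For the two-dimensional Euler equations, define two-point numerical fluxes (for all pairs of states with $\rho,p>0$) by $$f^{x}_{\rho}=\{\{\rho\}\}_{\log}\{\{v_x\}\},\quad f^x_{\rho v_x}=\{\{v_x\}\}f^x_\rho+\frac{\{\{\rho\}\}}{\{\{1/RT\}\}},\quad f^x_{\rho v_y}=\{\{v_y\}\}f^x_\rho,$$ $$f^x_{\rho e}=\left(\frac{1}{\gamma-1}\frac{\{\{RT\}\}_{\mathrm{geo}}^2}{\{\{RT\}\}_{\log}}-\frac{\{\{v_x^2\}\}+\{\{v_y^2\}\}}{2}\right)f^x_\rho+\{\{v_x\}\}f^x_{\rho v_x}+\{\{v_y\}\}f^x_{\rho v_y},$$ and $$f^{y}_{\rho}=\{\{\rho\}\}_{\log}\{\{v_y\}\},\quad f^y_{\rho v_x}=\{\{v_x\}\}f^y_\rho,\quad f^y_{\rho v_y}=\{\{v_y\}\}f^y_\rho+\frac{\{\{\rho\}\}}{\{\{1/RT\}\}},$$ $$f^y_{\rho e}=\left(\frac{1}{\gamma-1}\frac{\{\{RT\}\}_{\mathrm{geo}}^2}{\{\{RT\}\}_{\log}}-\frac{\{\{v_x^2\}\}+\{\{v_y^2\}\}}{2}\right)f^y_\rho+\{\{v_x\}\}f^y_{\rho v_x}+\{\{v_y\}\}f^y_{\rho v_y}.$$ These fluxes are entropy conservative and consistent. Additionally, they are kinetic energy preserving with numerical pressure flux $p^{\mathrm{num}}=\{\{\rho\}\}/\{\{1/RT\}\}$.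
   Context: Euler equations: $\partial_tu+\partial_xf_x(u)+\partial_yf_y(u)=0$, $u=(\rho,\rho v_x,\rho v_y,\rho e)^T$, $f_x=(\rho v_x,\rho v_x^2+p,\rho v_xv_y,(\rho e+p)v_x)^T$, $f_y=(\rho v_y,\rho v_xv_y,\rho v_y^2+p,(\rho e+p)v_y)^T$, $p=(\gamma-1)(\rho e-\frac12\rho v^2)$, $v^2=v_x^2+v_y^2$, $\gamma>1$ constant, $\rho,p>0$; $RT:=p/\rho$. With $s=\log(p/\rho^\gamma)$, the entropy is $U=-\rho s/(\gamma-1)$, the entropy variables are $w=\left(\frac{\gamma}{\gamma-1}-\frac{s}{\gamma-1}-\frac{\rho v^2}{2p},\frac{\rho v_x}{p},\frac{\rho v_y}{p},-\frac{\rho}{p}\right)^T$ and the flux potentials are $\psi_x=\rho v_x$, $\psi_y=\rho v_y$. Means of a quantity $a$ with values $a_-,a_+$ at the states $u_-,u_+$: $\{\{a\}\}=\frac{a_-+a_+}2$; for $a_\pm>0$, $\{\{a\}\}_{\log}=\frac{a_+-a_-}{\log a_+-\log a_-}$ (and $=a$ if $a_-=a_+=a$) and $\{\{a\}\}_{\mathrm{geo}}=\sqrt{a_+a_-}$. A two-point flux $f^j=(f^j_\rho,f^j_{\rho v_x},f^j_{\rho v_y},f^j_{\rho e})^T(u_-,u_+)$, $j\in\{x,y\}$, is consistent if $f^j(u,u)=f_j(u)$; entropy conservative if $(w_+-w_-)\cdot f^j(u_-,u_+)-(\psi_{j,+}-\psi_{j,-})=0$ for all pairs of states; kinetic energy preserving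 with numerical pressure flux $p^{\mathrm{num}}$ if $f^j_{\rho v_j}=\{\{v_j\}\}f^j_\rho+p^{\mathrm{num}}$ with $p^{\mathrm{num}}$ a consistent approximation of the pressure, i.e. $p^{\mathrm{num}}(u,u)=p$. *)

theory Defs
  imports "HOL-Analysis.Analysis"
begin

lemma vector_4 [simp]:
  "(vector [a, b, c, d] :: ('a::zero) ^ 4) $ 1 = a"
  "(vector [a, b, c, d] :: ('a::zero) ^ 4) $ 2 = b"
  "(vector [a, b, c, d] :: ('a::zero) ^ 4) $ 3 = c"
  "(vector [a, b, c, d] :: ('a::zero) ^ 4) $ 4 = d"
  unfolding vector_def by simp_all

text \<open>A state is the vector of conserved variables \<open>(\<rho>, \<rho> v\<^sub>x, \<rho> v\<^sub>y, \<rho> e)\<close>; all other quantities are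
  functions of it. The adiabatic constant \<open>\<gamma>\<close> is passed explicitly wherever it enters.\<close>

type_synonym state = "real ^ 4"

definition density :: "state \<Rightarrow> real" where
  "density u = u $ 1"

definition vx :: "state \<Rightarrow> real" where
  "vx u = u $ 2 / density u"

definition vy :: "state \<Rightarrow> real" where
  "vy u = u $ 3 / density u"

definition total_energy :: "state \<Rightarrow> real" where
  "total_energy u = u $ 4"

definition pressure :: "real \<Rightarrow> state \<Rightarrow> real" where
  "pressure \<gamma> u = (\<gamma> - 1) * (total_energy u - 1 / 2 * density u * ((vx u)\<^sup>2 + (vy u)\<^sup>2))"

definition admissible :: "real \<Rightarrow> state \<Rightarrow> bool" where
  "admissible \<gamma> u \<longleftrightarrow> density u > 0 \<and> pressure \<gamma> u > 0"

definition RT :: "real \<Rightarrow> state \<Rightarrow> real" where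
  "RT \<gamma> u = pressure \<gamma> u / density u"

datatype direction = X | Y

fun velocity :: "direction \<Rightarrow> state \<Rightarrow> real" where
  "velocity X u = vx u"
| "velocity Y u = vy u"

fun euler_flux :: "real \<Rightarrow> direction \<Rightarrow> state \<Rightarrow> state" where
  "euler_flux \<gamma> X u = vector
    [density u * vx u,
     density u * (vx u)\<^sup>2 + pressure \<gamma> u,
     density u * vx u * vy u,
     (total_energy u + pressure \<gamma> u) * vx u]"
| "euler_flux \<gamma> Y u = vector
    [density u * vy u,
     density u * vx u * vy u,
     density u * (vy u)\<^sup>2 + pressure \<gamma> u,
     (total_energy u + pressure \<gamma> u) * vy u]"

definition specific_entropy :: "real \<Rightarrow> state \<Rightarrow> real" where
  "specific_entropy \<gamma> u = ln (pressure \<gamma> u / density u powr \<gamma>)"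

text \<open>The entropy variables are the gradient, with respect to the conserved variables, of the
  entropy \<open>U = - \<rho> s / (\<gamma> - 1)\<close>.\<close>

definition entropy_vars :: "real \<Rightarrow> state \<Rightarrow> real ^ 4" where
  "entropy_vars \<gamma> u = vector
    [\<gamma> / (\<gamma> - 1) - specific_entropy \<gamma> u / (\<gamma> - 1)
       - density u * ((vx u)\<^sup>2 + (vy u)\<^sup>2) / (2 * pressure \<gamma> u),
     density u * vx u / pressure \<gamma> u,
     density u * vy u / pressure \<gamma> u,
     - (density u / pressure \<gamma> u)]"

definition flux_potential :: "direction \<Rightarrow> state \<Rightarrow> real" where
  "flux_potential j u = density u * velocity j u"

text \<open>Means of a quantity \<open>a\<close> between a left state \<open>um\<close> and a right state \<open>up\<close>.\<close>

definition mean :: "(state \<Rightarrow> real) \<Rightarrow> state \<Rightarrow> state \<Rightarrow> real" where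
  "mean a um up = (a um + a up) / 2"

definition log_mean :: "(state \<Rightarrow> real) \<Rightarrow> state \<Rightarrow> state \<Rightarrow> real" where
  "log_mean a um up =
    (if a um = a up then a um else (a up - a um) / (ln (a up) - ln (a um)))"

definition geo_mean :: "(state \<Rightarrow> real) \<Rightarrow> state \<Rightarrow> state \<Rightarrow> real" where
  "geo_mean a um up = sqrt (a up * a um)"

type_synonym two_point_flux = "state \<Rightarrow> state \<Rightarrow> state"

definition consistent :: "real \<Rightarrow> direction \<Rightarrow> two_point_flux \<Rightarrow> bool" where
  "consistent \<gamma> j f \<longleftrightarrow> (\<forall>u. admissible \<gamma> u \<longrightarrow> f u u = euler_flux \<gamma> j u)"

definition entropy_conservative :: "real \<Rightarrow> direction \<Rightarrow> two_point_flux \<Rightarrow> bool" where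
  "entropy_conservative \<gamma> j f \<longleftrightarrow>
    (\<forall>um up. admissible \<gamma> um \<longrightarrow> admissible \<gamma> up \<longrightarrow>
      (entropy_vars \<gamma> up - entropy_vars \<gamma> um) \<bullet> f um up
        - (flux_potential j up - flux_potential j um) = 0)"

fun momentum_component :: "direction \<Rightarrow> state \<Rightarrow> real" where
  "momentum_component X g = g $ 2"
| "momentum_component Y g = g $ 3"

definition kinetic_energy_preserving ::
    "real \<Rightarrow> direction \<Rightarrow> (state \<Rightarrow> state \<Rightarrow> real) \<Rightarrow> two_point_flux \<Rightarrow> bool" where
  "kinetic_energy_preserving \<gamma> j pnum f \<longleftrightarrow>
    (\<forall>um up. admissible \<gamma> um \<longrightarrow> admissible \<gamma> up \<longrightarrow>
      momentum_component j (f um up) = mean (velocity j) um up * f um up $ 1 + pnum um up) \<and>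
    (\<forall>u. admissible \<gamma> u \<longrightarrow> pnum u u = pressure \<gamma> u)"

definition pnum :: "real \<Rightarrow> state \<Rightarrow> state \<Rightarrow> real" where
  "pnum \<gamma> um up = mean density um up / mean (\<lambda>u. 1 / RT \<gamma> u) um up"

fun num_flux :: "real \<Rightarrow> direction \<Rightarrow> two_point_flux" where
  "num_flux \<gamma> X um up =
    (let f_rho = log_mean density um up * mean vx um up;
         f_rho_vx = mean vx um up * f_rho
           + mean density um up / mean (\<lambda>u. 1 / RT \<gamma> u) um up;
         f_rho_vy = mean vy um up * f_rho;
         f_rho_e =
           (1 / (\<gamma> - 1) * ((geo_mean (RT \<gamma>) um up)\<^sup>2 / log_mean (RT \<gamma>) um up)
             - (mean (\<lambda>u. (vx u)\<^sup>2) um up + mean (\<lambda>u. (vy u)\<^sup>2) um up) / 2) * f_rho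
           + mean vx um up * f_rho_vx + mean vy um up * f_rho_vy
     in vector [f_rho, f_rho_vx, f_rho_vy, f_rho_e])"
| "num_flux \<gamma> Y um up =
    (let f_rho = log_mean density um up * mean vy um up;
         f_rho_vx = mean vx um up * f_rho;
         f_rho_vy = mean vy um up * f_rho
           + mean density um up / mean (\<lambda>u. 1 / RT \<gamma> u) um up;
         f_rho_e =
           (1 / (\<gamma> - 1) * ((geo_mean (RT \<gamma>) um up)\<^sup>2 / log_mean (RT \<gamma>) um up)
             - (mean (\<lambda>u. (vx u)\<^sup>2) um up + mean (\<lambda>u. (vy u)\<^sup>2) um up) / 2) * f_rho
           + mean vx um up * f_rho_vx + mean vy um up * f_rho_vy
     in vector [f_rho, f_rho_vx, f_rho_vy, f_rho_e])"

end

theory Submission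
  imports Defs
begin

text \<open>With \<open>b = 1/RT\<close>, the density entropy variable is
  \<open>ln \<rho> - ln RT / (\<gamma> - 1) - b v\<^sup>2 / 2\<close> up to a constant and the others are
  \<open>b v\<^sub>x\<close>, \<open>b v\<^sub>y\<close>, \<open>- b\<close>. The logarithmic mean of \<open>\<rho>\<close> turns the jump of \<open>ln \<rho>\<close> into that of \<open>\<rho>\<close>,
  while \<open>geo\<^sup>2 / log\<close> turns the jump of \<open>b\<close> into minus that of \<open>ln RT\<close>, so that the
  logarithms disappear. What remains cancels by the product rule
  \<open>[ab] = {a}[b] + [a]{b}\<close> for jumps and arithmetic means.\<close>

lemma log_mean_mult_ln_jump:
  assumes "a um > 0" "a up > 0"
  shows "log_mean a um up * (ln (a up) - ln (a um)) = a up - a um"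
  using assms by (simp add: log_mean_def)

text \<open>The jump of \<open>1 / a\<close> is minus the jump of \<open>a\<close> over the product
  of both values; the squared geometric mean cancels that product.\<close>

lemma geo_mean_squared_div_log_mean:
  assumes "a um > 0" "a up > 0"
  shows "(geo_mean a um up)\<^sup>2 / log_mean a um up * (1 / a up - 1 / a um) = ln (a um) - ln (a up)"
proof (cases "a um = a up")
  case False
  have geo: "(geo_mean a um up)\<^sup>2 = a up * a um"
    using assms by (simp add: geo_mean_def)
  have "ln (a up) \<noteq> ln (a um)" "a up \<noteq> a um"
    using False assms by simp_all
  then show ?thesis
    unfolding geo using assms by (simp add: log_mean_def field_simps)
qed simp

lemma RT_pos: "admissible \<gamma> u \<Longrightarrow> RT \<gamma> u > 0"
  by (simp add: admissible_def RT_def)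

text \<open>Since p / \<rho>^\<gamma> = RT \<rho>^(1 - \<gamma>), the entropy splits into separate
  logarithms of density and temperature, one for each logarithmic mean.\<close>

lemma entropy_vars_RT:
  assumes "\<gamma> > 1" "admissible \<gamma> u"
  shows "entropy_vars \<gamma> u = vector
    [\<gamma> / (\<gamma> - 1) + ln (density u) - ln (RT \<gamma> u) / (\<gamma> - 1)
       - 1 / RT \<gamma> u * ((vx u)\<^sup>2 + (vy u)\<^sup>2) / 2,
     1 / RT \<gamma> u * vx u, 1 / RT \<gamma> u * vy u, - (1 / RT \<gamma> u)]"
proof -
  have pos: "density u > 0" "pressure \<gamma> u > 0"
    using assms(2) by (simp_all add: admissible_def)
  have "specific_entropy \<gamma> u = ln (RT \<gamma> u) - (\<gamma> - 1) * ln (density u)"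
    using pos by (simp add: specific_entropy_def RT_def ln_div ln_powr algebra_simps)
  then have "- (specific_entropy \<gamma> u / (\<gamma> - 1)) = ln (density u) - ln (RT \<gamma> u) / (\<gamma> - 1)"
    using assms(1) by (simp add: diff_divide_distrib)
  then show ?thesis
    by (simp add: entropy_vars_def RT_def algebra_simps add_divide_distrib)
qed

text \<open>Entropy conservation with the logarithms eliminated: \<open>a\<close> is the velocity in the
  direction of the flux, \<open>c\<close> the transverse one, \<open>l\<close> and \<open>t\<close> stand for \<open>ln \<rho>\<close> and
  \<open>ln RT / (\<gamma> - 1)\<close>, and \<open>h\<close> is \<open>geo\<^sup>2 / log\<close> over \<open>\<gamma> - 1\<close>.\<close>

lemma entropy_balance:
  fixes am ap :: real
  assumes l: "L * (lp - lm) = rp - rm"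
    and t: "h * (bp - bm) = tm - tp"
    and P: "P * ((bm + bp) / 2) = (rm + rp) / 2"
    and F: "F = L * ((am + ap) / 2)"
    and A: "A = (am + ap) / 2 * F + P"
    and C: "C = (cm + cp) / 2 * F"
    and E: "E = (h - ((am\<^sup>2 + ap\<^sup>2) / 2 + (cm\<^sup>2 + cp\<^sup>2) / 2) / 2) * F
              + (am + ap) / 2 * A + (cm + cp) / 2 * C"
  shows "((lp - tp - bp * (ap\<^sup>2 + cp\<^sup>2) / 2) - (lm - tm - bm * (am\<^sup>2 + cm\<^sup>2) / 2)) * F
       + (bp * ap - bm * am) * A + (bp * cp - bm * cm) * C - (bp - bm) * E = rp * ap - rm * am"
    (is "?lhs = _")
proof -
  \<comment> \<open>By the product rule and [c^2] = 2{c}[c], all kinetic terms multiplying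
    \<open>F\<close> cancel in both directions; the pressure leaves P([ba] - [b]{a}) =
    P{b}[a].\<close>
  have "?lhs = (L * (lp - lm)) * ((am + ap) / 2) + (tm - tp - h * (bp - bm)) * F
      + (P * ((bm + bp) / 2)) * (ap - am)"
    unfolding E C A unfolding F by (simp add: field_simps power2_eq_square)
  also have "\<dots> = rp * ap - rm * am"
    unfolding l t P by (simp add: field_simps)
  finally show ?thesis .
qed

lemma num_flux_entropy_conservative:
  assumes "\<gamma> > 1"
  shows "entropy_conservative \<gamma> j (num_flux \<gamma> j)"
  unfolding entropy_conservative_def
proof (intro allI impI)
  fix um up
  assume adm: "admissible \<gamma> um" "admissible \<gamma> up"
  let ?b = "\<lambda>u. 1 / RT \<gamma> u"
  let ?h = "1 / (\<gamma> - 1) * ((geo_mean (RT \<gamma>) um up)\<^sup>2 / log_mean (RT \<gamma>) um up)"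
  have l: "log_mean density um up * (ln (density up) - ln (density um)) = density up - density um"
    using adm by (intro log_mean_mult_ln_jump) (simp_all add: admissible_def)
  have t: "?h * (?b up - ?b um) = ln (RT \<gamma> um) / (\<gamma> - 1) - ln (RT \<gamma> up) / (\<gamma> - 1)"
    unfolding mult.assoc geo_mean_squared_div_log_mean[OF adm[THEN RT_pos]]
    by (simp add: diff_divide_distrib)
  have "?b um + ?b up > 0"
    using adm[THEN RT_pos] by (intro add_pos_pos) simp_all
  then have "mean ?b um up \<noteq> 0"
    by (simp add: mean_def)
  then have "mean density um up / mean ?b um up * mean ?b um up = mean density um up"
    by simp
  then have P: "mean density um up / mean ?b um up * ((?b um + ?b up) / 2)
      = (density um + density up) / 2"
    by (simp only: mean_def)
  define f where "f = num_flux \<gamma> j um up"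
  \<comment> \<open>The constant \<gamma> / (\<gamma> - 1) drops out of the jump.\<close>
  have inner: "(entropy_vars \<gamma> up - entropy_vars \<gamma> um) \<bullet> f =
      ((ln (density up) - ln (RT \<gamma> up) / (\<gamma> - 1) - ?b up * ((vx up)\<^sup>2 + (vy up)\<^sup>2) / 2)
        - (ln (density um) - ln (RT \<gamma> um) / (\<gamma> - 1) - ?b um * ((vx um)\<^sup>2 + (vy um)\<^sup>2) / 2)) * f $ 1
      + (?b up * vx up - ?b um * vx um) * f $ 2 + (?b up * vy up - ?b um * vy um) * f $ 3
      - (?b up - ?b um) * f $ 4"
    unfolding entropy_vars_RT[OF assms adm(1)] entropy_vars_RT[OF assms adm(2)]
    by (simp add: inner_vec_def sum_4 algebra_simps)
  have "(entropy_vars \<gamma> up - entropy_vars \<gamma> um) \<bullet> f = flux_potential j up - flux_potential j um"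
  proof (cases j)
    case X
    have "((ln (density up) - ln (RT \<gamma> up) / (\<gamma> - 1) - ?b up * ((vx up)\<^sup>2 + (vy up)\<^sup>2) / 2)
        - (ln (density um) - ln (RT \<gamma> um) / (\<gamma> - 1) - ?b um * ((vx um)\<^sup>2 + (vy um)\<^sup>2) / 2)) * f $ 1
      + (?b up * vx up - ?b um * vx um) * f $ 2 + (?b up * vy up - ?b um * vy um) * f $ 3
      - (?b up - ?b um) * f $ 4 = density up * vx up - density um * vx um"
      by (rule entropy_balance[OF l t P])
        (simp_all only: f_def X num_flux.simps Let_def vector_4 mean_def add_ac)
    then show ?thesis
      unfolding inner by (simp add: flux_potential_def X algebra_simps)
  next
    case Y
    \<comment> \<open>The summands are reordered so that \<open>vy\<close> takes the normal role and
      \<open>vx\<close> the transverse one in \<open>entropy_balance\<close>.\<close>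
    have "((ln (density up) - ln (RT \<gamma> up) / (\<gamma> - 1) - ?b up * ((vy up)\<^sup>2 + (vx up)\<^sup>2) / 2)
        - (ln (density um) - ln (RT \<gamma> um) / (\<gamma> - 1) - ?b um * ((vy um)\<^sup>2 + (vx um)\<^sup>2) / 2)) * f $ 1
      + (?b up * vy up - ?b um * vy um) * f $ 3 + (?b up * vx up - ?b um * vx um) * f $ 2
      - (?b up - ?b um) * f $ 4 = density up * vy up - density um * vy um"
      by (rule entropy_balance[OF l t P])
        (simp_all only: f_def Y num_flux.simps Let_def vector_4 mean_def add_ac)
    then show ?thesis
      unfolding inner by (simp add: flux_potential_def Y algebra_simps)
  qed
  then show "(entropy_vars \<gamma> up - entropy_vars \<gamma> um) \<bullet> num_flux \<gamma> j um up
      - (flux_potential j up - flux_potential j um) = 0"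
    by (simp add: f_def)
qed

lemma mean_diag [simp]: "mean a u u = a u"
  by (simp add: mean_def)

lemma log_mean_diag [simp]: "log_mean a u u = a u"
  by (simp add: log_mean_def)

lemma pnum_diag:
  assumes "admissible \<gamma> u"
  shows "pnum \<gamma> u u = pressure \<gamma> u"
  using assms by (simp add: pnum_def RT_def admissible_def)

lemma total_energy_pressure:
  assumes "\<gamma> > 1"
  shows "total_energy u = pressure \<gamma> u / (\<gamma> - 1) + density u * ((vx u)\<^sup>2 + (vy u)\<^sup>2) / 2"
  using assms by (simp add: pressure_def)

lemma num_flux_consistent:
  assumes "\<gamma> > 1"
  shows "consistent \<gamma> j (num_flux \<gamma> j)"
  unfolding consistent_def
proof (intro allI impI)
  fix u
  assume adm: "admissible \<gamma> u"
  have pos: "density u > 0" "pressure \<gamma> u > 0"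
    using adm by (simp_all add: admissible_def)
  have T: "(geo_mean (RT \<gamma>) u u)\<^sup>2 / RT \<gamma> u = pressure \<gamma> u / density u"
    using pos by (simp add: geo_mean_def RT_def)
  have p: "density u / (1 / RT \<gamma> u) = pressure \<gamma> u"
    using pos by (simp add: RT_def)
  \<comment> \<open>Here \<open>a\<close> is the normal velocity. The momentum terms of the energy
    flux add \<rho> v^2 \<open>a\<close> + p \<open>a\<close>, giving (\<rho>e + p)
    \<open>a\<close>.\<close>
  have e: "(1 / (\<gamma> - 1) * (pressure \<gamma> u / density u) - ((vx u)\<^sup>2 + (vy u)\<^sup>2) / 2) * (density u * a)
      = (total_energy u - density u * ((vx u)\<^sup>2 + (vy u)\<^sup>2)) * a" for a
  proof -
    define c where "c = 1 / (\<gamma> - 1)"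
    have "total_energy u = c * pressure \<gamma> u + density u * ((vx u)\<^sup>2 + (vy u)\<^sup>2) / 2"
      by (simp add: c_def total_energy_pressure[OF assms])
    then show ?thesis
      unfolding c_def[symmetric] using pos by (simp add: field_simps)
  qed
  show "num_flux \<gamma> j u u = euler_flux \<gamma> j u"
    by (cases j)
      (simp_all only: num_flux.simps euler_flux.simps Let_def mean_diag log_mean_diag T p e,
       simp_all add: vec_eq_iff forall_4 algebra_simps power2_eq_square)
qed

lemma num_flux_kinetic_energy_preserving:
  "kinetic_energy_preserving \<gamma> j (pnum \<gamma>) (num_flux \<gamma> j)"
  by (cases j) (simp_all add: kinetic_energy_preserving_def pnum_diag Let_def, simp_all add: pnum_def mean_def)

theorem mainTheorem6:
  fixes \<gamma> :: real
  assumes "\<gamma> > 1"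
  shows "\<forall>j. entropy_conservative \<gamma> j (num_flux \<gamma> j) \<and>
             consistent \<gamma> j (num_flux \<gamma> j) \<and>
             kinetic_energy_preserving \<gamma> j (pnum \<gamma>) (num_flux \<gamma> j)"
  using assms num_flux_entropy_conservative num_flux_consistent num_flux_kinetic_energy_preserving
  by blast

end
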